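(* Let $\mathcal V_0=\mathbf{Set}$ and, for all $i\ge0$, let $P_i$ be an operad in $\mathcal V_i$ and $\mathcal V_{i+1}=(\mathcal V_i,P_i)\text{-}\mathbf{Cat}$. Given $n\ge 0$, let $Q^{(n)}$ be the associated $n$-dimensional globular operad. Then $Q^{(n)}$ is contractible if and only if for all $0\le i<n$ the operad $P_i$ is contractible.
   Context: **Operads and $(\mathcal V,P)$-categories.** "Operad" in a category $\mathcal V$ with finite products means a classical non-symmetric operad: objects $P(k)$ ($k\ge 0$), a unit $1\to P(1)$ and composition maps $P(m)\times P(k_1)\times\cdots\times P(k_m)\to P(k_1+\cdots+k_m)$, associative and unital. A $\mathcal V$-graph $A$ is a set $A_0$ of objects with an object $A(a,a')\in\mathcal V$ for all $a,a'\in A_0$; morphisms are functions on objects with morphisms $A(a,a')\to B(Fa,Fa')$. They form $\mathcal V\text{-}\mathbf{Gph}$. A $(\mathcal V,P)$-category is a $\mathcal V$-graph $A$ with, for all $k\ge0$ and $a_0,\dots,a_k\in A_0$, a morphism $\gamma: P(k)\times A(a_{k-1},a_k)\times\cdots\times A(a_0,a_1)\to A(a_0,a_k)$ (for $k=0$: $P(0)\to A(a,a)$), compatible with the operad structure: the unit of $P$ acts as the identity, and, for a composable string cut into $m$ consecutive blocks, applying $p_i\in P(k_i)$ to the $i$-th block along the string and then $p\in P(m)$ to the results agrees with applying the operadic composite $p(p_1,\dots,p_m)$ to the whole string. Morphisms are $\mathcal V$-graph morphisms commuting with all $\gamma$; the category is $(\mathcal V,P)\text{-}\mathbf{Cat}$.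 **Contractibility of the $P_i$.** A set is contractible iff it has exactly one element. If $\mathcal V$ has a notion of contractible object: an operad $P$ in $\mathcal V$ is contractible if each $P(k)$ is; a $\mathcal V$-graph $A$ is contractible if $A_0\neq\emptyset$ and every $A(a,a')$ is contractible; a $(\mathcal V,P)$-category is contractible if its underlying $\mathcal V$-graph is. This defines contractibility in each $\mathcal V_i$. **Globular sets.** $n\text{-}\mathbf{GSet}$ is the category of $n$-globular sets (sets $A_0,\dots,A_n$ with $s,t:A_m\to A_{m-1}$, $ss=st$, $ts=tt$). It is identified with $n\text{-}\mathbf{Gph}$, where $0\text{-}\mathbf{Gph}=\mathbf{Set}$, $n\text{-}\mathbf{Gph}=((n-1)\text{-}\mathbf{Gph})\text{-}\mathbf{Gph}$: the 0-cells are the objects, the $m$-cells ($m\geq 1$) are the $(m-1)$-cells of the hom-objects. The forgetful functor $U_n:\mathcal V_n\to n\text{-}\mathbf{GSet}$ is $U_0=\mathrm{id}$, and $U_nA$ has objects $A_0$ and homs $U_{n-1}(A(a,a'))$. **The monads $Q^{(n)}$.** For a presheaf category $\mathcal V$ and operad $R$ in $\mathcal V$, $\mathbf{fc}_{(\mathcal V,R)}$ is the free $(\mathcal V,R)$-category monad on $\mathcal V\text{-}\mathbf{Gph}$: identity on objects, and $$(\mathbf{fc}_{(\mathcal V,R)}A)(a,a')=\coprod_{k\ge0,\ a=a_0,\dots,a_k=a'}R(k)\times A(a_{k-1},a_k)\times\cdots\times A(a_0,a_1),$$ with unit and multiplication from those of $R$. A functor or monad $F$ on $\mathcal V$ induces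 $F_*$ on $\mathcal V\text{-}\mathbf{Gph}$, the identity on objects and $F$ on hom-objects. Set $Q^{(0)}=\mathrm{id}$ on $\mathbf{Set}$ and, for $n>0$, with $\mathcal V=(n-1)\text{-}\mathbf{GSet}$, $T=Q^{(n-1)}$ (so that $\mathcal V^T$ is $\mathcal V_{n-1}$) and $R(k)=U_{n-1}(P_{n-1}(k))$, $$Q^{(n)}=\mathbf{fc}_{(\mathcal V,R)}\circ (Q^{(n-1)})_* ,$$ with monad structure from the distributive law $T_*\circ\mathbf{fc}_{(\mathcal V,R)}\Rightarrow\mathbf{fc}_{(\mathcal V,R)}\circ T_*$ whose components on coproduct summands are the canonical maps $T(R(k)\times A_k\times\cdots\times A_1)\to R(k)\times TA_k\times\cdots\times TA_1$ given by $T$ of the projections followed, on the first factor, by the $T$-algebra action $T R(k)\to R(k)$ ($T$ preserves coproducts). The algebras of $Q^{(n)}$ are $\mathcal V_n$. **Globular operad.** Taking all $P_i$ to be the terminal operad $1$ in this construction gives the free strict $n$-category monad $T^{(n)}$ on $n\text{-}\mathbf{GSet}$, which is cartesian. The maps $P_i\to1$ induce inductively a cartesian natural transformation $Q^{(n)}\Rightarrow T^{(n)}$ commuting with monad structures; this is an $n$-dimensional globular operad, with underlying collection $p:Q^{(n)}1\to T^{(n)}1$. **Contractible globular operad.** A collection $p:A\to T^{(n)}1$ is contractible if: (i) for all $0\le m<n$, all parallel $m$-cells $a,b\in A$ ($sa=sb$, $ta=tb$; no condition if $m=0$) and each $(m+1)$-cell $y:pa\to pb$ in $T^{(n)}1$,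 there is an $(m+1)$-cell $x:a\to b$ in $A$ with $px=y$; (ii) any parallel $n$-cells $a,b\in A$ with $pa=pb$ are equal. A globular operad is contractible if its underlying collection is. *)

theory Defs
  imports "HOL-Library.FuncSet"
begin

section \<open>Cells, and raw morphisms of iterated graphs\<close>

text \<open>
  All the sets of objects occurring below are subsets of one type of cells over an arbitrary type
  of atoms. It is closed under finite tuples (used for finite products) and under tagging by a
  list of cells (used for coproducts indexed by strings of objects).
\<close>

datatype 'a cell = Atom 'a | Tup (entries: "'a cell list") | Tag (tag: "'a cell list") (untag: "'a cell")

definition tuples :: "'a cell set list \<Rightarrow> 'a cell set" where
  "tuples Ss = {Tup xs | xs. list_all2 (\<in>) xs Ss}"

text \<open>
  A morphism of sets is a function; a morphism of graphs is a function on objects together with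
  a morphism \<open>A(a,a') \<rightarrow> B(Fa,Fa')\<close> for all objects \<open>a\<close>, \<open>a'\<close>. Since morphisms of
  \<open>(\<V>,P)\<close>-categories are morphisms of \<open>\<V>\<close>-graphs with a property, the same type serves for the
  morphisms of all the categories \<open>\<V>\<^sub>n\<close> and of the categories of \<open>n\<close>-graphs.
\<close>

datatype 'a gmor =
    Map0 (mob: "'a cell \<Rightarrow> 'a cell")
  | Map (mob: "'a cell \<Rightarrow> 'a cell") (mhom: "'a cell \<Rightarrow> 'a cell \<Rightarrow> 'a gmor")

text \<open>
  For a string of objects \<open>as = [a\<^sub>0, \<dots>, a\<^sub>k]\<close>, the list
  \<open>[H a\<^sub>k\<^sub>-\<^sub>1 a\<^sub>k, \<dots>, H a\<^sub>0 a\<^sub>1]\<close>.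
\<close>

definition path_homs :: "('c \<Rightarrow> 'c \<Rightarrow> 'o) \<Rightarrow> 'c list \<Rightarrow> 'o list" where
  "path_homs H as = rev (map (\<lambda>j. H (as ! j) (as ! Suc j)) [0..<length as - 1])"


section \<open>Operads in a category with finite products\<close>

text \<open>
  Categories with chosen finite products, and with a notion of contractible object. Morphisms do
  not carry their domain, so composition (\<open>comp \<V> A g f\<close> is \<open>g\<close> after \<open>f : A \<rightarrow> B\<close>)
  and tupling (\<open>tpl \<V> A [f\<^sub>1, \<dots>, f\<^sub>r] : A \<rightarrow> prd \<V> [B\<^sub>1, \<dots>, B\<^sub>r]\<close>) have the common domain
  as an argument. \<open>prd \<V> []\<close> is the terminal object.
\<close>

record ('o, 'm) fpcat =
  obj :: "'o set"
  hom :: "'o \<Rightarrow> 'o \<Rightarrow> 'm set"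
  ident :: "'o \<Rightarrow> 'm"
  comp :: "'o \<Rightarrow> 'm \<Rightarrow> 'm \<Rightarrow> 'm"
  prd :: "'o list \<Rightarrow> 'o"
  prj :: "'o list \<Rightarrow> nat \<Rightarrow> 'm"
  tpl :: "'o \<Rightarrow> 'm list \<Rightarrow> 'm"
  contr :: "'o set"

text \<open>
  \<open>op_comp P [k\<^sub>1, \<dots>, k\<^sub>m] : P(m) \<times> P(k\<^sub>1) \<times> \<cdots> \<times> P(k\<^sub>m) \<rightarrow> P(k\<^sub>1 + \<cdots> + k\<^sub>m)\<close>.
\<close>

record ('o, 'm) operad =
  op_obj :: "nat \<Rightarrow> 'o"
  op_unit :: 'm
  op_comp :: "nat list \<Rightarrow> 'm"

text \<open>
  In the associativity law \<open>jss ! i\<close> lists the arities of the operations to be substituted into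
  the \<open>i\<close>-th of \<open>m\<close> operations of arities \<open>ks\<close>, which are themselves substituted into an
  operation of arity \<open>m\<close>. The two morphisms compared have domain
  \<open>P(m) \<times> \<Prod>\<^sub>i P(ks ! i) \<times> \<Prod>\<^sub>i\<^sub>,\<^sub>j P(jss ! i ! j)\<close>, and \<open>start i\<close> is the index of the factor
  \<open>P(jss ! i ! 0)\<close>.
\<close>

definition operad_assoc :: "('o, 'm) fpcat \<Rightarrow> ('o, 'm) operad \<Rightarrow> nat list list \<Rightarrow> bool" where
  "operad_assoc V P jss \<longleftrightarrow>
    (let m = length jss;
         js = concat jss;
         ks = map length jss;
         start = (\<lambda>i. Suc m + sum_list (take i ks));
         Ds = op_obj P m # map (op_obj P) ks @ map (op_obj P) js;
         D = prd V Ds;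
         \<pi> = prj V Ds
     in comp V D (op_comp P js)
          (tpl V D (comp V D (op_comp P ks) (tpl V D (map \<pi> [0..<Suc m]))
                    # map \<pi> [Suc m..<Suc m + length js]))
      = comp V D (op_comp P (map sum_list jss))
          (tpl V D (\<pi> 0
                    # map (\<lambda>i. comp V D (op_comp P (jss ! i))
                               (tpl V D (\<pi> (Suc i) # map \<pi> [start i..<start (Suc i)]))) [0..<m])))"

definition is_operad :: "('o, 'm) fpcat \<Rightarrow> ('o, 'm) operad \<Rightarrow> bool" where
  "is_operad V P \<longleftrightarrow>
    (\<forall>k. op_obj P k \<in> obj V) \<and>
    op_unit P \<in> hom V (prd V []) (op_obj P 1) \<and>
    (\<forall>ks. op_comp P ks \<in> hom V (prd V (op_obj P (length ks) # map (op_obj P) ks)) (op_obj P (sum_list ks))) \<and>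
    (\<forall>k. let D = op_obj P k; u = comp V D (op_unit P) (tpl V D [])
         in comp V D (op_comp P [k]) (tpl V D [u, ident V D]) = ident V D \<and>
            comp V D (op_comp P (replicate k 1)) (tpl V D (ident V D # replicate k u)) = ident V D) \<and>
    (\<forall>jss. operad_assoc V P jss)"

definition contractible_operad :: "('o, 'm) fpcat \<Rightarrow> ('o, 'm) operad \<Rightarrow> bool" where
  "contractible_operad V P \<longleftrightarrow> (\<forall>k. op_obj P k \<in> contr V)"

definition terminal_operad :: "('o, 'm) fpcat \<Rightarrow> ('o, 'm) operad" where
  "terminal_operad V =
    \<lparr>op_obj = (\<lambda>k. prd V []),
     op_unit = tpl V (prd V []) [],
     op_comp = (\<lambda>ks. tpl V (prd V (prd V [] # map (\<lambda>k. prd V []) ks)) [])\<rparr>"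


section \<open>The categories \<open>\<V>\<^sub>i\<close>\<close>

text \<open>
  The objects of all the \<open>\<V>\<^sub>i\<close> have to live in a single type: an object is either a set, or a
  graph enriched in such objects together with, for each string \<open>[a\<^sub>0, \<dots>, a\<^sub>k]\<close>
  of objects, the morphism \<open>\<gamma> : P(k) \<times> A(a\<^sub>k\<^sub>-\<^sub>1,a\<^sub>k) \<times> \<cdots> \<times> A(a\<^sub>0,a\<^sub>1) \<rightarrow> A(a\<^sub>0,a\<^sub>k)\<close>.
\<close>

datatype 'a vobj =
    VSet (vob: "'a cell set")
  | VCat (vob: "'a cell set") (vhom: "'a cell \<Rightarrow> 'a cell \<Rightarrow> 'a vobj") (vact: "'a cell list \<Rightarrow> 'a gmor")

type_synonym 'a vcategory = "('a vobj, 'a gmor) fpcat"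
type_synonym 'a voperad = "('a vobj, 'a gmor) operad"

text \<open>Functions are extensional, so that equality of morphisms is equality of functions on the domain.\<close>

definition Set_cat :: "'a vcategory" where
  "Set_cat =
    \<lparr>obj = range VSet,
     hom = (\<lambda>A B. Map0 ` (vob A \<rightarrow>\<^sub>E vob B)),
     ident = (\<lambda>A. Map0 (\<lambda>x\<in>vob A. x)),
     comp = (\<lambda>A g f. Map0 (\<lambda>x\<in>vob A. mob g (mob f x))),
     prd = (\<lambda>As. VSet (tuples (map vob As))),
     prj = (\<lambda>As i. Map0 (\<lambda>x\<in>tuples (map vob As). entries x ! i)),
     tpl = (\<lambda>A fs. Map0 (\<lambda>x\<in>vob A. Tup (map (\<lambda>f. mob f x) fs))),
     contr = {VSet {x} | x. True}\<rparr>"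

text \<open>
  The compatibility of \<open>\<gamma>\<close> with operadic composition, for the string \<open>as = [a\<^sub>0, \<dots>, a\<^sub>K]\<close> with
  \<open>K = k\<^sub>1 + \<cdots> + k\<^sub>m\<close>: the \<open>(i+1)\<close>-st block is the string from \<open>as ! s i\<close> to
  \<open>as ! s (i+1)\<close>. The two morphisms compared have domain
  \<open>P(m) \<times> P(k\<^sub>1) \<times> \<cdots> \<times> P(k\<^sub>m) \<times> A(a\<^sub>K\<^sub>-\<^sub>1,a\<^sub>K) \<times> \<cdots> \<times> A(a\<^sub>0,a\<^sub>1)\<close>, in which
  \<open>A(a\<^sub>j,a\<^sub>j\<^sub>+\<^sub>1)\<close> is the factor with index \<open>m + K - j\<close>, counting from \<open>0\<close>.
\<close>

definition act_assoc :: "'a vcategory \<Rightarrow> 'a voperad \<Rightarrow> 'a vobj \<Rightarrow> nat list \<Rightarrow> 'a cell list \<Rightarrow> bool" where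
  "act_assoc V P A ks as \<longleftrightarrow>
    (let m = length ks;
         K = sum_list ks;
         s = (\<lambda>i. sum_list (take i ks));
         block = (\<lambda>i. map ((!) as) [s i..<Suc (s (Suc i))]);
         Ds = op_obj P m # map (op_obj P) ks @ path_homs (vhom A) as;
         D = prd V Ds;
         \<pi> = prj V Ds
     in comp V D (vact A as)
          (tpl V D (comp V D (op_comp P ks) (tpl V D (map \<pi> [0..<Suc m]))
                    # map \<pi> [Suc m..<Suc m + K]))
      = comp V D (vact A (map (\<lambda>i. as ! s i) [0..<Suc m]))
          (tpl V D (\<pi> 0
                    # rev (map (\<lambda>i. comp V D (vact A (block i))
                                 (tpl V D (\<pi> (Suc i)
                                           # rev (map (\<lambda>j. \<pi> (m + K - j)) [s i..<s (Suc i)]))))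
                               [0..<m]))))"

definition is_PCat :: "'a vcategory \<Rightarrow> 'a voperad \<Rightarrow> 'a vobj \<Rightarrow> bool" where
  "is_PCat V P A \<longleftrightarrow>
    (\<exists>X H g. A = VCat X H g) \<and>
    (\<forall>a\<in>vob A. \<forall>b\<in>vob A. vhom A a b \<in> obj V) \<and>
    (\<forall>as\<in>lists (vob A). as \<noteq> [] \<longrightarrow>
       vact A as \<in> hom V (prd V (op_obj P (length as - 1) # path_homs (vhom A) as)) (vhom A (hd as) (last as))) \<and>
    (\<forall>a\<in>vob A. \<forall>b\<in>vob A.
       let D = vhom A a b
       in comp V D (vact A [a, b]) (tpl V D [comp V D (op_unit P) (tpl V D []), ident V D]) = ident V D) \<and>
    (\<forall>ks. \<forall>as\<in>lists (vob A). length as = Suc (sum_list ks) \<longrightarrow> act_assoc V P A ks as)"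

text \<open>Morphisms of \<open>(\<V>,P)\<close>-categories: compatibility with \<open>\<gamma>\<close> at the string \<open>as\<close>.\<close>

definition act_preserving :: "'a vcategory \<Rightarrow> 'a voperad \<Rightarrow> 'a vobj \<Rightarrow> 'a vobj \<Rightarrow> 'a gmor \<Rightarrow> 'a cell list \<Rightarrow> bool" where
  "act_preserving V P A B f as \<longleftrightarrow>
    (let k = length as - 1;
         Ds = op_obj P k # path_homs (vhom A) as;
         D = prd V Ds;
         \<pi> = prj V Ds
     in comp V D (mhom f (hd as) (last as)) (vact A as)
      = comp V D (vact B (map (mob f) as))
          (tpl V D (\<pi> 0 # map (\<lambda>j. comp V D (path_homs (mhom f) as ! j) (\<pi> (Suc j))) [0..<k])))"

definition PCat_hom :: "'a vcategory \<Rightarrow> 'a voperad \<Rightarrow> 'a vobj \<Rightarrow> 'a vobj \<Rightarrow> 'a gmor set" where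
  "PCat_hom V P A B =
    {Map f F | f F.
       f \<in> vob A \<rightarrow>\<^sub>E vob B \<and>
       F \<in> (\<Pi>\<^sub>E a\<in>vob A. \<Pi>\<^sub>E b\<in>vob A. hom V (vhom A a b) (vhom B (f a) (f b))) \<and>
       (\<forall>as\<in>lists (vob A). as \<noteq> [] \<longrightarrow> act_preserving V P A B (Map f F) as)}"

definition hom_tuple :: "'a vobj list \<Rightarrow> 'a cell \<Rightarrow> 'a cell \<Rightarrow> 'a vobj list" where
  "hom_tuple As x y = map (\<lambda>i. vhom (As ! i) (entries x ! i) (entries y ! i)) [0..<length As]"

definition PCat_prd :: "'a vcategory \<Rightarrow> 'a voperad \<Rightarrow> 'a vobj list \<Rightarrow> 'a vobj" where
  "PCat_prd V P As =
    VCat (tuples (map vob As))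
      (\<lambda>x y. prd V (hom_tuple As x y))
      (\<lambda>xs. let k = length xs - 1;
                Hs = path_homs (hom_tuple As) xs;
                Ds = op_obj P k # map (prd V) Hs;
                D = prd V Ds;
                \<pi> = prj V Ds
            in tpl V D
                 (map (\<lambda>i. comp V D (vact (As ! i) (map (\<lambda>x. entries x ! i) xs))
                            (tpl V D (\<pi> 0 # map (\<lambda>j. comp V D (prj V (Hs ! j) i) (\<pi> (Suc j))) [0..<k])))
                   [0..<length As]))"

definition PCat :: "'a vcategory \<Rightarrow> 'a voperad \<Rightarrow> 'a vcategory" where
  "PCat V P =
    \<lparr>obj = {A. is_PCat V P A},
     hom = PCat_hom V P,
     ident = (\<lambda>A. Map (\<lambda>a\<in>vob A. a) (\<lambda>a\<in>vob A. \<lambda>b\<in>vob A. ident V (vhom A a b))),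
     comp = (\<lambda>A g f. Map (\<lambda>a\<in>vob A. mob g (mob f a))
                         (\<lambda>a\<in>vob A. \<lambda>b\<in>vob A.
                            comp V (vhom A a b) (mhom g (mob f a) (mob f b)) (mhom f a b))),
     prd = PCat_prd V P,
     prj = (\<lambda>As i. let X = tuples (map vob As)
                   in Map (\<lambda>x\<in>X. entries x ! i) (\<lambda>x\<in>X. \<lambda>y\<in>X. prj V (hom_tuple As x y) i)),
     tpl = (\<lambda>A fs. Map (\<lambda>a\<in>vob A. Tup (map (\<lambda>f. mob f a) fs))
                       (\<lambda>a\<in>vob A. \<lambda>b\<in>vob A. tpl V (vhom A a b) (map (\<lambda>f. mhom f a b) fs))),
     contr = {A. is_PCat V P A \<and> vob A \<noteq> {} \<and> (\<forall>a\<in>vob A. \<forall>b\<in>vob A. vhom A a b \<in> contr V)}\<rparr>"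

primrec V_cat :: "(nat \<Rightarrow> 'a voperad) \<Rightarrow> nat \<Rightarrow> 'a vcategory" where
  "V_cat P 0 = Set_cat"
| "V_cat P (Suc i) = PCat (V_cat P i) (P i)"

text \<open>
  The sequence \<open>P\<^sub>i = 1\<close>: the \<open>i\<close>-th category is that of strict \<open>i\<close>-categories, and
  \<open>V_cat one_operads = strict_cat\<close>.
\<close>

primrec strict_cat :: "nat \<Rightarrow> 'a vcategory" where
  "strict_cat 0 = Set_cat"
| "strict_cat (Suc i) = PCat (strict_cat i) (terminal_operad (strict_cat i))"

definition one_operads :: "nat \<Rightarrow> 'a voperad" where
  "one_operads i = terminal_operad (strict_cat i)"

lemma V_cat_one_operads: "V_cat one_operads i = strict_cat i"
  by (induction i) (simp_all add: one_operads_def)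


section \<open>Globular sets as iterated graphs\<close>

datatype 'a gph =
    Gph0 (gob: "'a cell set")
  | Gph (gob: "'a cell set") (ghom: "'a cell \<Rightarrow> 'a cell \<Rightarrow> 'a gph")

primrec U_gph :: "nat \<Rightarrow> 'a vobj \<Rightarrow> 'a gph" where
  "U_gph 0 A = Gph0 (vob A)"
| "U_gph (Suc n) A = Gph (vob A) (\<lambda>a b. U_gph n (vhom A a b))"

text \<open>
  The \<open>m\<close>-cells of the globular set given by an iterated graph: the \<open>0\<close>-cells are the objects,
  and an \<open>(m+1)\<close>-cell \<open>Cell a b x\<close> is an \<open>m\<close>-cell \<open>x\<close> of the hom-object \<open>A(a,b)\<close>.
\<close>

datatype 'a gcell = Cell0 "'a cell" | Cell "'a cell" "'a cell" "'a gcell"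

primrec cells :: "nat \<Rightarrow> 'a gph \<Rightarrow> 'a gcell set" where
  "cells 0 A = Cell0 ` gob A"
| "cells (Suc m) A = {Cell a b x | a b x. a \<in> gob A \<and> b \<in> gob A \<and> x \<in> cells m (ghom A a b)}"

fun src :: "'a gcell \<Rightarrow> 'a gcell" where
  "src (Cell a b (Cell0 x)) = Cell0 a"
| "src (Cell a b (Cell c d y)) = Cell a b (src (Cell c d y))"

fun tgt :: "'a gcell \<Rightarrow> 'a gcell" where
  "tgt (Cell a b (Cell0 x)) = Cell0 b"
| "tgt (Cell a b (Cell c d y)) = Cell a b (tgt (Cell c d y))"

primrec gapp :: "'a gcell \<Rightarrow> 'a gmor \<Rightarrow> 'a gcell" where
  "gapp (Cell0 a) = (\<lambda>f. Cell0 (mob f a))"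
| "gapp (Cell a b x) = (\<lambda>f. Cell (mob f a) (mob f b) (gapp x (mhom f a b)))"

definition parallel :: "nat \<Rightarrow> 'a gcell \<Rightarrow> 'a gcell \<Rightarrow> bool" where
  "parallel m a b \<longleftrightarrow> m = 0 \<or> (src a = src b \<and> tgt a = tgt b)"

definition contractible_collection :: "nat \<Rightarrow> 'a gph \<Rightarrow> 'a gph \<Rightarrow> 'a gmor \<Rightarrow> bool" where
  "contractible_collection n A B p \<longleftrightarrow>
    (\<forall>m<n. \<forall>a\<in>cells m A. \<forall>b\<in>cells m A. parallel m a b \<longrightarrow>
       (\<forall>y\<in>cells (Suc m) B. src y = gapp a p \<and> tgt y = gapp b p \<longrightarrow>
          (\<exists>x\<in>cells (Suc m) A. src x = a \<and> tgt x = b \<and> gapp x p = y))) \<and>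
    (\<forall>a\<in>cells n A. \<forall>b\<in>cells n A. parallel n a b \<and> gapp a p = gapp b p \<longrightarrow> a = b)"

text \<open>
  Products and coproducts of \<open>n\<close>-graphs. The 0-cells of a coproduct are tagged by the summand,
  and the homs between 0-cells of different summands are empty.
\<close>

primrec gempty :: "nat \<Rightarrow> 'a gph" where
  "gempty 0 = Gph0 {}"
| "gempty (Suc n) = Gph {} (\<lambda>a b. gempty n)"

primrec gprod :: "nat \<Rightarrow> 'a gph list \<Rightarrow> 'a gph" where
  "gprod 0 As = Gph0 (tuples (map gob As))"
| "gprod (Suc n) As =
     Gph (tuples (map gob As))
       (\<lambda>x y. gprod n (map (\<lambda>i. ghom (As ! i) (entries x ! i) (entries y ! i)) [0..<length As]))"

definition gcoprod :: "nat \<Rightarrow> 'a cell list set \<Rightarrow> ('a cell list \<Rightarrow> 'a gph) \<Rightarrow> 'a gph" where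
  "gcoprod n I A =
    (let X = {Tag t x | t x. t \<in> I \<and> x \<in> gob (A t)}
     in case n of
          0 \<Rightarrow> Gph0 X
        | Suc n' \<Rightarrow> Gph X (\<lambda>z w. if tag z = tag w then ghom (A (tag z)) (untag z) (untag w) else gempty n'))"

text \<open>
  Morphisms of \<open>n\<close>-graphs, as bare families of functions: none of the following depends on the
  domain or codomain.
\<close>

primrec gid :: "nat \<Rightarrow> 'a gmor" where
  "gid 0 = Map0 (\<lambda>x. x)"
| "gid (Suc n) = Map (\<lambda>x. x) (\<lambda>x y. gid n)"

primrec gcomp :: "nat \<Rightarrow> 'a gmor \<Rightarrow> 'a gmor \<Rightarrow> 'a gmor" where
  "gcomp 0 g f = Map0 (\<lambda>x. mob g (mob f x))"
| "gcomp (Suc n) g f =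
     Map (\<lambda>x. mob g (mob f x)) (\<lambda>x y. gcomp n (mhom g (mob f x) (mob f y)) (mhom f x y))"

primrec gproj :: "nat \<Rightarrow> nat \<Rightarrow> 'a gmor" where
  "gproj 0 i = Map0 (\<lambda>x. entries x ! i)"
| "gproj (Suc n) i = Map (\<lambda>x. entries x ! i) (\<lambda>x y. gproj n i)"

primrec gtuple :: "nat \<Rightarrow> 'a gmor list \<Rightarrow> 'a gmor" where
  "gtuple 0 fs = Map0 (\<lambda>x. Tup (map (\<lambda>f. mob f x) fs))"
| "gtuple (Suc n) fs = Map (\<lambda>x. Tup (map (\<lambda>f. mob f x) fs)) (\<lambda>x y. gtuple n (map (\<lambda>f. mhom f x y) fs))"

definition gprod_map :: "nat \<Rightarrow> 'a gmor list \<Rightarrow> 'a gmor" where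
  "gprod_map n fs = gtuple n (map (\<lambda>i. gcomp n (fs ! i) (gproj n i)) [0..<length fs])"

definition ginj :: "nat \<Rightarrow> 'a cell list \<Rightarrow> 'a gmor" where
  "ginj n t = (case n of 0 \<Rightarrow> Map0 (Tag t) | Suc n' \<Rightarrow> Map (Tag t) (\<lambda>x y. gid n'))"

text \<open>
  \<open>guntag\<close> is the inverse of a coproduct injection, defined on that summand only. \<open>gcase\<close>
  glues a family of morphisms, each of them defined on the part of the domain given by the tags of
  the 0-cells, into a single one. So \<open>gcase n (\<lambda>z. gcomp n (f (tag z)) (guntag n))\<close> is the
  morphism out of a coproduct whose component at the summand \<open>t\<close> is \<open>f t\<close>.
\<close>

definition guntag :: "nat \<Rightarrow> 'a gmor" where
  "guntag n = (case n of 0 \<Rightarrow> Map0 untag | Suc n' \<Rightarrow> Map untag (\<lambda>x y. gid n'))"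

definition gcase :: "nat \<Rightarrow> ('a cell \<Rightarrow> 'a gmor) \<Rightarrow> 'a gmor" where
  "gcase n f =
    (case n of
       0 \<Rightarrow> Map0 (\<lambda>z. mob (f z) z)
     | Suc n' \<Rightarrow> Map (\<lambda>z. mob (f z) z) (\<lambda>z w. mhom (f z) z w))"


section \<open>The free \<open>(\<V>,R)\<close>-category monad, for \<open>\<V>\<close> the category of \<open>n\<close>-graphs\<close>

definition paths :: "'c set \<Rightarrow> 'c \<Rightarrow> 'c \<Rightarrow> 'c list set" where
  "paths X a b = {as \<in> lists X. as \<noteq> [] \<and> hd as = a \<and> last as = b}"

definition fc :: "nat \<Rightarrow> (nat \<Rightarrow> 'a gph) \<Rightarrow> 'a gph \<Rightarrow> 'a gph" where
  "fc n R A =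
    Gph (gob A)
      (\<lambda>a b. gcoprod n (paths (gob A) a b)
               (\<lambda>as. gprod n (R (length as - 1) # path_homs (ghom A) as)))"

text \<open>
  The morphism \<open>fc\<^bsub>R\<^esub>A \<rightarrow> fc\<^bsub>R'\<^esub>B\<close> induced by \<open>f : A \<rightarrow> B\<close> and
  \<open>\<rho> k : R(k) \<rightarrow> R'(k)\<close>.
\<close>

definition fc_map :: "nat \<Rightarrow> (nat \<Rightarrow> 'a gmor) \<Rightarrow> 'a gmor \<Rightarrow> 'a gmor" where
  "fc_map n \<rho> f =
    Map (mob f)
      (\<lambda>a b. gcase n (\<lambda>z.
         let as = tag z
         in gcomp n (ginj n (map (mob f) as))
              (gcomp n (gprod_map n (\<rho> (length as - 1) # path_homs (mhom f) as)) (guntag n))))"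

definition fc_unit :: "nat \<Rightarrow> 'a gmor \<Rightarrow> 'a gmor" where
  "fc_unit n u =
    Map (\<lambda>a. a) (\<lambda>a b. gcomp n (ginj n [a, b]) (gtuple n [gcomp n u (gtuple n []), gid n]))"

text \<open>
  Multiplication. A 0-cell \<open>z\<close> of a hom-object of \<open>fc (fc A)\<close> is
  \<open>Tag [a\<^sub>0, \<dots>, a\<^sub>m] (Tup [r, Tag t\<^sub>m x\<^sub>m, \<dots>, Tag t\<^sub>1 x\<^sub>1])\<close> with \<open>r\<close> in
  \<open>R(m)\<close> and \<open>x\<^sub>i = Tup (r\<^sub>i # \<dots>)\<close> in \<open>R(k\<^sub>i) \<times> \<cdots>\<close>, where \<open>t\<^sub>i\<close> is a string of
  length \<open>k\<^sub>i\<close> from \<open>a\<^sub>i\<^sub>-\<^sub>1\<close> to \<open>a\<^sub>i\<close>. It goes to the summand of the concatenated string,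
  \<open>r, r\<^sub>1, \<dots>, r\<^sub>m\<close> being composed by \<open>c [k\<^sub>1, \<dots>, k\<^sub>m]\<close>.
\<close>

definition fc_mult :: "nat \<Rightarrow> (nat list \<Rightarrow> 'a gmor) \<Rightarrow> 'a gmor" where
  "fc_mult n c =
    Map (\<lambda>a. a)
      (\<lambda>a b. gcase n (\<lambda>z.
         let as = tag z;
             ts = rev (map tag (tl (entries (untag z))));
             m = length ts;
             ks = map (\<lambda>t. length t - 1) ts;
             \<pi> = (\<lambda>i j. gcomp n (gproj n j) (gproj n (m + 1 - i)));
             q = gcomp n (c ks) (gtuple n (gproj n 0 # map (\<lambda>i. \<pi> i 0) [1..<m + 1]));
             xs = concat (rev (map (\<lambda>i. map (\<pi> i) [1..<ks ! (i - 1) + 1]) [1..<m + 1]))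
         in gcomp n (ginj n (hd as # concat (map tl ts)))
              (gcomp n (gtuple n (q # xs))
                (gcomp n (gprod_map n (gid n # replicate m (guntag n))) (guntag n)))))"

definition gstar :: "('a gph \<Rightarrow> 'a gph) \<Rightarrow> 'a gph \<Rightarrow> 'a gph" where
  "gstar F A = Gph (gob A) (\<lambda>a b. F (ghom A a b))"

definition gstar_map :: "('a gmor \<Rightarrow> 'a gmor) \<Rightarrow> 'a gmor \<Rightarrow> 'a gmor" where
  "gstar_map M f = Map (mob f) (\<lambda>a b. M (mhom f a b))"


section \<open>The monads \<open>Q\<^sup>(\<^sup>n\<^sup>)\<close> and the associated globular operads\<close>

primrec Q_obj :: "(nat \<Rightarrow> 'a voperad) \<Rightarrow> nat \<Rightarrow> 'a gph \<Rightarrow> 'a gph" where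
  "Q_obj P 0 A = A"
| "Q_obj P (Suc n) A = fc n (\<lambda>k. U_gph n (op_obj (P n) k)) (gstar (Q_obj P n) A)"

primrec Q_map :: "nat \<Rightarrow> 'a gmor \<Rightarrow> 'a gmor" where
  "Q_map 0 f = f"
| "Q_map (Suc n) f = fc_map n (\<lambda>k. gid n) (gstar_map (Q_map n) f)"

text \<open>The algebra structure \<open>Q\<^sup>(\<^sup>n\<^sup>)(U\<^sub>n A) \<rightarrow> U\<^sub>n A\<close> of an object \<open>A\<close> of \<open>\<V>\<^sub>n\<close>.\<close>

primrec Q_alg :: "nat \<Rightarrow> 'a vobj \<Rightarrow> 'a gmor" where
  "Q_alg 0 A = gid 0"
| "Q_alg (Suc n) A =
     Map (\<lambda>a. a)
       (\<lambda>a b. gcase n (\<lambda>z.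
          let as = tag z
          in gcomp n (vact A as)
               (gcomp n (gprod_map n (gid n # path_homs (\<lambda>a b. Q_alg n (vhom A a b)) as)) (guntag n))))"

text \<open>
  The distributive law \<open>T\<^sub>* \<circ> fc \<Rightarrow> fc \<circ> T\<^sub>*\<close> for \<open>T = Q\<^sup>(\<^sup>n\<^sup>)\<close> and \<open>R(k) = U\<^sub>n(P(k))\<close>. As
  \<open>T\<close> is the identity on 0-cells and preserves coproducts, a 0-cell \<open>z\<close> of \<open>T\<close> of a
  coproduct of graphs is tagged by a summand, and near \<open>z\<close> the inverse of the canonical map from
  the coproduct of the \<open>T\<close>'s is \<open>T\<close> applied to \<open>guntag\<close>.
\<close>

definition Q_dist :: "nat \<Rightarrow> 'a voperad \<Rightarrow> 'a gmor" where
  "Q_dist n P =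
    Map (\<lambda>a. a)
      (\<lambda>a b. gcase n (\<lambda>z.
         let as = tag z; k = length as - 1
         in gcomp n (ginj n as)
              (gcomp n
                (gtuple n (gcomp n (Q_alg n (op_obj P k)) (Q_map n (gproj n 0))
                           # map (\<lambda>i. Q_map n (gproj n (Suc i))) [0..<k]))
                (Q_map n (guntag n)))))"

text \<open>
  Unit and multiplication, and the transformation \<open>Q\<^sup>(\<^sup>n\<^sup>) \<Rightarrow> T\<^sup>(\<^sup>n\<^sup>)\<close> induced by \<open>P\<^sub>i \<rightarrow> 1\<close>.
  The formulas for their components are the same for all globular sets \<open>A\<close>.
\<close>

primrec Q_unit :: "(nat \<Rightarrow> 'a voperad) \<Rightarrow> nat \<Rightarrow> 'a gmor" where
  "Q_unit P 0 = gid 0"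
| "Q_unit P (Suc n) =
     gcomp (Suc n) (fc_unit n (op_unit (P n))) (Map (\<lambda>a. a) (\<lambda>a b. Q_unit P n))"

primrec Q_mult :: "(nat \<Rightarrow> 'a voperad) \<Rightarrow> nat \<Rightarrow> 'a gmor" where
  "Q_mult P 0 = gid 0"
| "Q_mult P (Suc n) =
     gcomp (Suc n) (fc_mult n (op_comp (P n)))
       (gcomp (Suc n)
         (fc_map n (\<lambda>k. gid n) (fc_map n (\<lambda>k. gid n) (Map (\<lambda>a. a) (\<lambda>a b. Q_mult P n))))
         (fc_map n (\<lambda>k. gid n) (Q_dist n (P n))))"

primrec Q_to_T :: "nat \<Rightarrow> 'a gmor" where
  "Q_to_T 0 = gid 0"
| "Q_to_T (Suc n) = fc_map n (\<lambda>k. gtuple n []) (Map (\<lambda>a. a) (\<lambda>a b. Q_to_T n))"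

abbreviation T_obj :: "nat \<Rightarrow> 'a gph \<Rightarrow> 'a gph" where
  "T_obj \<equiv> Q_obj one_operads"

text \<open>
  The data of an \<open>n\<close>-dimensional globular operad: an endofunctor on globular sets, with a unit, a
  multiplication and a natural transformation to \<open>T\<^sup>(\<^sup>n\<^sup>)\<close>. The underlying collection is the
  component of the latter at the terminal globular set \<open>gprod n []\<close>.
\<close>

record 'a globular_operad =
  go_obj :: "'a gph \<Rightarrow> 'a gph"
  go_map :: "'a gmor \<Rightarrow> 'a gmor"
  go_unit :: "'a gph \<Rightarrow> 'a gmor"
  go_mult :: "'a gph \<Rightarrow> 'a gmor"
  go_proj :: "'a gph \<Rightarrow> 'a gmor"

definition Q_operad :: "(nat \<Rightarrow> 'a voperad) \<Rightarrow> nat \<Rightarrow> 'a globular_operad" where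
  "Q_operad P n =
    \<lparr>go_obj = Q_obj P n, go_map = Q_map n,
     go_unit = (\<lambda>A. Q_unit P n), go_mult = (\<lambda>A. Q_mult P n), go_proj = (\<lambda>A. Q_to_T n)\<rparr>"

definition contractible_globular_operad :: "nat \<Rightarrow> 'a globular_operad \<Rightarrow> bool" where
  "contractible_globular_operad n G \<longleftrightarrow>
    contractible_collection n (go_obj G (gprod n [])) (T_obj n (gprod n [])) (go_proj G (gprod n []))"

end

theory Submission
  imports Defs
begin

text \<open>
  Call a morphism of iterated graphs a trivial fibration if it is surjective on objects, is a
  trivial fibration on all homs, and is injective in dimension \<open>n\<close>. A morphism surjective on
  0-cells is a trivial fibration iff it satisfies the contractibility condition for collections,
  and an object \<open>A\<close> is contractible iff \<open>A \<rightarrow> 1\<close> is a trivial fibration. The collection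
  \<open>Q\<^sup>(\<^sup>n\<^sup>+\<^sup>1\<^sup>)1 \<rightarrow> T\<^sup>(\<^sup>n\<^sup>+\<^sup>1\<^sup>)1\<close> has one object on both sides, and its only hom is the coproduct over
  \<open>k\<close> of \<open>P\<^sub>n(k) \<times> (Q\<^sup>(\<^sup>n\<^sup>)1)\<^sup>k \<rightarrow> 1 \<times> (T\<^sup>(\<^sup>n\<^sup>)1)\<^sup>k\<close>. A coproduct of morphisms is a trivial fibration
  iff each summand is, and a product of trivial fibrations is one. Conversely, the factors of a
  product which is a trivial fibration are trivial fibrations, because \<open>T\<^sup>(\<^sup>n\<^sup>)1\<close> has enough
  (identity) cells in all dimensions. Hence \<open>Q\<^sup>(\<^sup>n\<^sup>+\<^sup>1\<^sup>)\<close> is contractible iff \<open>Q\<^sup>(\<^sup>n\<^sup>)\<close> and all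
  \<open>P\<^sub>n(k)\<close> are.
\<close>

section \<open>Morphisms, trivial fibrations and reflexivity, by recursion on depth\<close>

primrec is_gmor :: "nat \<Rightarrow> 'a gph \<Rightarrow> 'a gph \<Rightarrow> 'a gmor \<Rightarrow> bool" where
  "is_gmor 0 A B p \<longleftrightarrow> mob p ` gob A \<subseteq> gob B"
| "is_gmor (Suc n) A B p \<longleftrightarrow> mob p ` gob A \<subseteq> gob B \<and>
     (\<forall>a\<in>gob A. \<forall>b\<in>gob A. is_gmor n (ghom A a b) (ghom B (mob p a) (mob p b)) (mhom p a b))"

text \<open>Surjectivity is imposed on 0-cells as well, which a contractible collection does not
  ask; with it the notion passes unchanged to homs. Containment of the image in \<open>gob B\<close>
  is left to \<open>is_gmor\<close>.\<close>

primrec trivial_fib :: "nat \<Rightarrow> 'a gph \<Rightarrow> 'a gph \<Rightarrow> 'a gmor \<Rightarrow> bool" where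
  "trivial_fib 0 A B p \<longleftrightarrow> gob B \<subseteq> mob p ` gob A \<and> inj_on (mob p) (gob A)"
| "trivial_fib (Suc n) A B p \<longleftrightarrow> gob B \<subseteq> mob p ` gob A \<and>
     (\<forall>a\<in>gob A. \<forall>b\<in>gob A. trivial_fib n (ghom A a b) (ghom B (mob p a) (mob p b)) (mhom p a b))"

text \<open>Keeps only the existence part of identity cells: iterated endo-homs are inhabited, with
  no chosen elements.\<close>

primrec reflexive :: "nat \<Rightarrow> 'a gph \<Rightarrow> bool" where
  "reflexive 0 A \<longleftrightarrow> gob A \<noteq> {}"
| "reflexive (Suc n) A \<longleftrightarrow> gob A \<noteq> {} \<and> (\<forall>a\<in>gob A. reflexive n (ghom A a a))"

lemma is_gmor_mob: "is_gmor n A B p \<Longrightarrow> a \<in> gob A \<Longrightarrow> mob p a \<in> gob B"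
  by (cases n) auto

lemma trivial_fib_surj: "trivial_fib n A B p \<Longrightarrow> gob B \<subseteq> mob p ` gob A"
  by (cases n) auto

lemma reflexive_nonempty: "reflexive n A \<Longrightarrow> gob A \<noteq> {}"
  by (cases n) auto


section \<open>Contractible collections\<close>

lemma src_Cell: "src (Cell a b x) = (case x of Cell0 _ \<Rightarrow> Cell0 a | Cell _ _ _ \<Rightarrow> Cell a b (src x))"
  by (cases x) auto

lemma tgt_Cell: "tgt (Cell a b x) = (case x of Cell0 _ \<Rightarrow> Cell0 b | Cell _ _ _ \<Rightarrow> Cell a b (tgt x))"
  by (cases x) auto

text \<open>Only a 1-cell \<open>Cell a b (Cell0 x)\<close> loses its outer pair of objects on
  passing to the boundary; in higher dimensions boundaries are taken inside the hom.\<close>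

lemma src_Cell_Suc: "x \<in> cells (Suc m) A \<Longrightarrow> src (Cell a b x) = Cell a b (src x)"
  and tgt_Cell_Suc: "x \<in> cells (Suc m) A \<Longrightarrow> tgt (Cell a b x) = Cell a b (tgt x)"
  by (auto simp: src_Cell tgt_Cell)

text \<open>For 1-cells, being parallel means having equal end objects, which matches the absence of
  any condition on 0-cells of a hom.\<close>

lemma parallel_Cell:
  assumes "x \<in> cells m A" "y \<in> cells m B"
  shows "parallel (Suc m) (Cell a b x) (Cell c d y) \<longleftrightarrow> a = c \<and> b = d \<and> parallel m x y"
proof (cases m)
  case 0
  with assms show ?thesis by (auto simp: parallel_def)
next
  case (Suc k)
  with assms show ?thesis by (auto simp: parallel_def src_Cell_Suc tgt_Cell_Suc)
qed

definition cell_lifting :: "nat \<Rightarrow> 'a gph \<Rightarrow> 'a gph \<Rightarrow> 'a gmor \<Rightarrow> bool" where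
  "cell_lifting m A B p \<longleftrightarrow>
    (\<forall>a\<in>cells m A. \<forall>b\<in>cells m A. parallel m a b \<longrightarrow>
       (\<forall>y\<in>cells (Suc m) B. src y = gapp a p \<and> tgt y = gapp b p \<longrightarrow>
          (\<exists>x\<in>cells (Suc m) A. src x = a \<and> tgt x = b \<and> gapp x p = y)))"

definition cell_inj :: "nat \<Rightarrow> 'a gph \<Rightarrow> 'a gmor \<Rightarrow> bool" where
  "cell_inj n A p \<longleftrightarrow>
    (\<forall>a\<in>cells n A. \<forall>b\<in>cells n A. parallel n a b \<and> gapp a p = gapp b p \<longrightarrow> a = b)"

lemma contractible_collection_alt:
  "contractible_collection n A B p \<longleftrightarrow> (\<forall>m<n. cell_lifting m A B p) \<and> cell_inj n A p"
  by (simp add: contractible_collection_def cell_lifting_def cell_inj_def)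

text \<open>All 0-cells are parallel, and the 1-cells between two of them are the objects of a
  hom.\<close>

lemma cell_lifting_0:
  assumes "mob p ` gob A \<subseteq> gob B"
  shows "cell_lifting 0 A B p \<longleftrightarrow>
    (\<forall>a\<in>gob A. \<forall>b\<in>gob A. gob (ghom B (mob p a) (mob p b)) \<subseteq> mob (mhom p a b) ` gob (ghom A a b))"
    (is "?L \<longleftrightarrow> ?R")
proof
  assume L: ?L
  show ?R
  proof (intro ballI subsetI)
    fix a b y assume *: "a \<in> gob A" "b \<in> gob A" "y \<in> gob (ghom B (mob p a) (mob p b))"
    then have "Cell (mob p a) (mob p b) (Cell0 y) \<in> cells (Suc 0) B"
      using assms by auto
    with * have "\<exists>x\<in>cells (Suc 0) A. src x = Cell0 a \<and> tgt x = Cell0 b \<and>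
        gapp x p = Cell (mob p a) (mob p b) (Cell0 y)"
      by (intro L[unfolded cell_lifting_def, rule_format]) (simp_all add: parallel_def)
    then show "y \<in> mob (mhom p a b) ` gob (ghom A a b)" by auto
  qed
next
  assume R: ?R
  show ?L
    unfolding cell_lifting_def
  proof (intro ballI impI)
    fix a b y
    assume a: "a \<in> cells 0 A" and b: "b \<in> cells 0 A" and y: "y \<in> cells (Suc 0) B"
      and st: "src y = gapp a p \<and> tgt y = gapp b p"
    obtain u v where u: "a = Cell0 u" "u \<in> gob A" and v: "b = Cell0 v" "v \<in> gob A"
      using a b by auto
    obtain z where "y = Cell (mob p u) (mob p v) (Cell0 z)" "z \<in> gob (ghom B (mob p u) (mob p v))"
      using y st u v by auto
    moreover from this R u v obtain x where "x \<in> gob (ghom A u v)" "z = mob (mhom p u v) x"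
      by blast
    ultimately show "\<exists>x\<in>cells (Suc 0) A. src x = a \<and> tgt x = b \<and> gapp x p = y"
      using u v by (intro bexI[of _ "Cell u v (Cell0 x)"]) auto
  qed
qed

text \<open>Parallel cells of positive dimension lie in a common hom, and so does every cell between
  them.\<close>

lemma cell_lifting_Suc:
  assumes "mob p ` gob A \<subseteq> gob B"
  shows "cell_lifting (Suc m) A B p \<longleftrightarrow>
    (\<forall>a\<in>gob A. \<forall>b\<in>gob A. cell_lifting m (ghom A a b) (ghom B (mob p a) (mob p b)) (mhom p a b))"
    (is "?L \<longleftrightarrow> ?R")
proof
  assume L: ?L
  show ?R
    unfolding cell_lifting_def
  proof (intro ballI impI)
    fix a b x x' y
    assume ab: "a \<in> gob A" "b \<in> gob A"
      and x: "x \<in> cells m (ghom A a b)" "x' \<in> cells m (ghom A a b)" "parallel m x x'"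
      and y: "y \<in> cells (Suc m) (ghom B (mob p a) (mob p b))"
        "src y = gapp x (mhom p a b) \<and> tgt y = gapp x' (mhom p a b)"
    let ?y = "Cell (mob p a) (mob p b) y"
    have mem: "Cell a b x \<in> cells (Suc m) A" "Cell a b x' \<in> cells (Suc m) A"
      using ab x by auto
    have par: "parallel (Suc m) (Cell a b x) (Cell a b x')"
      using parallel_Cell[OF x(1,2)] x(3) by simp
    have y': "?y \<in> cells (Suc (Suc m)) B"
      using assms ab y(1) by (subst cells.simps(2)) blast
    have st: "src ?y = gapp (Cell a b x) p \<and> tgt ?y = gapp (Cell a b x') p"
      using y by (simp add: src_Cell_Suc[OF y(1)] tgt_Cell_Suc[OF y(1)])
    from L mem par y' st obtain w where
      w: "w \<in> cells (Suc (Suc m)) A" "src w = Cell a b x" "tgt w = Cell a b x'" "gapp w p = ?y"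
      unfolding cell_lifting_def by blast
    from w(1) obtain c d v where v: "w = Cell c d v" "v \<in> cells (Suc m) (ghom A c d)"
      by (subst (asm) cells.simps(2)) blast
    \<comment> \<open>The boundary of \<open>w\<close> pins its outer objects to \<open>a\<close>
      and \<open>b\<close>.\<close>
    have "c = a" "d = b" "src v = x" "tgt v = x'" "gapp v (mhom p a b) = y"
      using w v by (auto simp: src_Cell_Suc[OF v(2)] tgt_Cell_Suc[OF v(2)])
    then show "\<exists>x''\<in>cells (Suc m) (ghom A a b).
        src x'' = x \<and> tgt x'' = x' \<and> gapp x'' (mhom p a b) = y"
      using v by blast
  qed
next
  assume R: ?R
  show ?L
    unfolding cell_lifting_def
  proof (intro ballI impI)
    fix u u' w
    assume u: "u \<in> cells (Suc m) A" "u' \<in> cells (Suc m) A" "parallel (Suc m) u u'"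
      and w: "w \<in> cells (Suc (Suc m)) B" "src w = gapp u p \<and> tgt w = gapp u' p"
    from u(1) obtain a b x where
      x: "u = Cell a b x" "a \<in> gob A" "b \<in> gob A" "x \<in> cells m (ghom A a b)" by auto
    from u(2) obtain a' b' x' where x': "u' = Cell a' b' x'" "x' \<in> cells m (ghom A a' b')" by auto
    have eq: "a' = a" "b' = b" and par: "parallel m x x'"
      using parallel_Cell[OF x(4) x'(2)] u(3) x(1) x'(1) by auto
    from w(1) obtain c d y where y: "w = Cell c d y" "y \<in> cells (Suc m) (ghom B c d)"
      by (subst (asm) cells.simps(2)) blast
    have "c = mob p a" "d = mob p b" "src y = gapp x (mhom p a b)" "tgt y = gapp x' (mhom p a b)"
      using w(2) x(1) x'(1) eq by (auto simp: y(1) src_Cell_Suc[OF y(2)] tgt_Cell_Suc[OF y(2)])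
    moreover from this R x x' eq par y obtain v where
      v: "v \<in> cells (Suc m) (ghom A a b)" "src v = x" "tgt v = x'" "gapp v (mhom p a b) = y"
      unfolding cell_lifting_def by blast
    moreover have "Cell a b v \<in> cells (Suc (Suc m)) A"
      using x v by (subst cells.simps(2)) blast
    ultimately show "\<exists>x\<in>cells (Suc (Suc m)) A. src x = u \<and> tgt x = u' \<and> gapp x p = w"
      using x(1) x'(1) eq y(1)
      by (intro bexI[of _ "Cell a b v"]) (auto simp: src_Cell_Suc[OF v(1)] tgt_Cell_Suc[OF v(1)])
  qed
qed

lemma cell_inj_Suc:
  "cell_inj (Suc n) A p \<longleftrightarrow> (\<forall>a\<in>gob A. \<forall>b\<in>gob A. cell_inj n (ghom A a b) (mhom p a b))"
    (is "?L \<longleftrightarrow> ?R")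
proof
  assume L: ?L
  show ?R
    unfolding cell_inj_def
  proof (intro ballI impI)
    fix a b x y
    assume *: "a \<in> gob A" "b \<in> gob A" "x \<in> cells n (ghom A a b)" "y \<in> cells n (ghom A a b)"
      "parallel n x y \<and> gapp x (mhom p a b) = gapp y (mhom p a b)"
    then have "Cell a b x = Cell a b y"
      by (intro L[unfolded cell_inj_def, rule_format]) (auto simp: parallel_Cell)
    then show "x = y" by simp
  qed
next
  assume R: ?R
  then show ?L
    unfolding cell_inj_def by (auto simp: parallel_Cell)
qed

lemma contractible_collection_Suc:
  assumes "mob p ` gob A \<subseteq> gob B"
  shows "contractible_collection (Suc n) A B p \<longleftrightarrow> (\<forall>a\<in>gob A. \<forall>b\<in>gob A.
    gob (ghom B (mob p a) (mob p b)) \<subseteq> mob (mhom p a b) ` gob (ghom A a b) \<and>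
    contractible_collection n (ghom A a b) (ghom B (mob p a) (mob p b)) (mhom p a b))"
  \<comment> \<open>\<open>All_less_Suc2\<close> splits off lifting in dimension 0, which is
    surjectivity on homs; the shifted dimensions give the condition for the homs.\<close>
  unfolding contractible_collection_alt All_less_Suc2 cell_lifting_0[OF assms]
    cell_lifting_Suc[OF assms] cell_inj_Suc
  by blast

text \<open>Lifting of 1-cells supplies the surjectivity that \<open>trivial_fib\<close> asks of
  each hom, so only surjectivity on the outermost 0-cells is left over.\<close>

lemma trivial_fib_iff_contractible_collection:
  "is_gmor n A B p \<Longrightarrow>
    trivial_fib n A B p \<longleftrightarrow> gob B \<subseteq> mob p ` gob A \<and> contractible_collection n A B p"
proof (induction n arbitrary: A B p)
  case 0
  show ?case
    by (auto simp: contractible_collection_alt cell_inj_def parallel_def inj_on_def)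
next
  case (Suc n)
  from Suc.prems have "mob p ` gob A \<subseteq> gob B" by simp
  with Suc show ?case by (auto simp: contractible_collection_Suc)
qed


section \<open>Products\<close>

lemma mem_tuples_iff:
  "x \<in> tuples Ss \<longleftrightarrow>
    (\<exists>xs. x = Tup xs \<and> length xs = length Ss \<and> (\<forall>i<length Ss. xs ! i \<in> Ss ! i))"
  by (auto simp: tuples_def list_all2_conv_all_nth)

lemma tuples_Nil: "tuples [] = {Tup []}"
  by (auto simp: mem_tuples_iff)

lemma gob_gprod: "gob (gprod n As) = tuples (map gob As)"
  by (cases n) auto

lemma ghom_gprod: "ghom (gprod (Suc n) As) x y =
    gprod n (map (\<lambda>i. ghom (As ! i) (entries x ! i) (entries y ! i)) [0..<length As])"
  by simp

lemma mob_gprod_map: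
  "mob (gprod_map n fs) x = Tup (map (\<lambda>i. mob (fs ! i) (entries x ! i)) [0..<length fs])"
  by (cases n) (auto simp: gprod_map_def)

text \<open>Lets the lemmas on products recurse on depth: the family of factors changes, but the
  form of the map does not.\<close>

lemma mhom_gprod_map: "mhom (gprod_map (Suc n) fs) x y =
    gprod_map n (map (\<lambda>i. mhom (fs ! i) (entries x ! i) (entries y ! i)) [0..<length fs])"
  by (auto simp: gprod_map_def intro!: arg_cong[where f = "gtuple n"])

lemma is_gmor_gprod_map:
  assumes "length As = length fs" "length Bs = length fs"
    and "\<And>i. i < length fs \<Longrightarrow> is_gmor n (As ! i) (Bs ! i) (fs ! i)"
  shows "is_gmor n (gprod n As) (gprod n Bs) (gprod_map n fs)"
  using assms
proof (induction n arbitrary: As Bs fs)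
  case 0
  then show ?case
    by (auto simp: gob_gprod mob_gprod_map mem_tuples_iff image_subset_iff simp del: gprod.simps)
next
  case (Suc n)
  have "mob (gprod_map (Suc n) fs) ` gob (gprod (Suc n) As) \<subseteq> gob (gprod (Suc n) Bs)"
    using Suc.prems
    by (auto simp: gob_gprod mob_gprod_map mem_tuples_iff image_subset_iff simp del: gprod.simps)
  moreover have "is_gmor n (ghom (gprod (Suc n) As) x y)
      (ghom (gprod (Suc n) Bs) (mob (gprod_map (Suc n) fs) x) (mob (gprod_map (Suc n) fs) y))
      (mhom (gprod_map (Suc n) fs) x y)"
    if "x \<in> gob (gprod (Suc n) As)" "y \<in> gob (gprod (Suc n) As)" for x y
    unfolding ghom_gprod mhom_gprod_map
    using that Suc.prems
    by (intro Suc.IH)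
      (auto simp: gob_gprod mob_gprod_map mem_tuples_iff simp del: gprod.simps)
  ultimately show ?case by (auto simp del: gprod.simps)
qed

lemma gprod_map_surj:
  assumes "length As = length fs" "length Bs = length fs"
    and "\<And>i. i < length fs \<Longrightarrow> gob (Bs ! i) \<subseteq> mob (fs ! i) ` gob (As ! i)"
  shows "gob (gprod n Bs) \<subseteq> mob (gprod_map n fs) ` gob (gprod n As)"
proof
  fix y assume "y \<in> gob (gprod n Bs)"
  then obtain ys where ys: "y = Tup ys" "length ys = length fs"
    "\<And>i. i < length fs \<Longrightarrow> ys ! i \<in> gob (Bs ! i)"
    using assms(2) by (auto simp: gob_gprod mem_tuples_iff)
  then have "\<forall>i. \<exists>x. i < length fs \<longrightarrow> x \<in> gob (As ! i) \<and> ys ! i = mob (fs ! i) x"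
    using assms(3) by blast
  then obtain x where x: "\<And>i. i < length fs \<Longrightarrow> x i \<in> gob (As ! i) \<and> ys ! i = mob (fs ! i) (x i)"
    by metis
  have "y = mob (gprod_map n fs) (Tup (map x [0..<length fs]))"
    using x ys by (auto simp: mob_gprod_map intro: nth_equalityI)
  moreover have "Tup (map x [0..<length fs]) \<in> gob (gprod n As)"
    using x assms(1) by (auto simp: gob_gprod mem_tuples_iff)
  ultimately show "y \<in> mob (gprod_map n fs) ` gob (gprod n As)" by blast
qed

lemma trivial_fib_gprod_map:
  assumes "length As = length fs" "length Bs = length fs"
    and "\<And>i. i < length fs \<Longrightarrow> trivial_fib n (As ! i) (Bs ! i) (fs ! i)"
  shows "trivial_fib n (gprod n As) (gprod n Bs) (gprod_map n fs)"
  using assms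
proof (induction n arbitrary: As Bs fs)
  case 0
  have "x = y" if "x \<in> gob (gprod 0 As)" "y \<in> gob (gprod 0 As)"
    "mob (gprod_map 0 fs) x = mob (gprod_map 0 fs) y" for x y
    using that 0
    by (auto simp: gob_gprod mob_gprod_map mem_tuples_iff inj_on_def simp del: gprod.simps
        intro!: nth_equalityI)
  moreover have "gob (gprod 0 Bs) \<subseteq> mob (gprod_map 0 fs) ` gob (gprod 0 As)"
    using 0 by (intro gprod_map_surj) auto
  ultimately show ?case by (auto intro!: inj_onI simp del: gprod.simps)
next
  case (Suc n)
  have "gob (gprod (Suc n) Bs) \<subseteq> mob (gprod_map (Suc n) fs) ` gob (gprod (Suc n) As)"
    using Suc.prems by (intro gprod_map_surj) auto
  moreover have "trivial_fib n (ghom (gprod (Suc n) As) x y)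
      (ghom (gprod (Suc n) Bs) (mob (gprod_map (Suc n) fs) x) (mob (gprod_map (Suc n) fs) y))
      (mhom (gprod_map (Suc n) fs) x y)"
    if "x \<in> gob (gprod (Suc n) As)" "y \<in> gob (gprod (Suc n) As)" for x y
    unfolding ghom_gprod mhom_gprod_map
    using that Suc.prems
    by (intro Suc.IH)
      (auto simp: gob_gprod mob_gprod_map mem_tuples_iff simp del: gprod.simps)
  ultimately show ?case by (auto simp del: gprod.simps)
qed

text \<open>
  The other factors must have elements for which the tuples can be completed; reflexivity provides
  them in every dimension, by using the same object as source and target.
\<close>

lemma trivial_fib_gprod_mapD:
  assumes "trivial_fib n (gprod n As) (gprod n Bs) (gprod_map n fs)"
    and "length As = length fs" "length Bs = length fs" "j < length fs"
    and "is_gmor n (As ! j) (Bs ! j) (fs ! j)"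
    and "\<And>i. i < length fs \<Longrightarrow> i \<noteq> j \<Longrightarrow> reflexive n (Bs ! i)"
  shows "trivial_fib n (As ! j) (Bs ! j) (fs ! j)"
  using assms
proof (induction n arbitrary: As Bs fs)
  case base: 0
  note len = base.prems(2-4)
  let ?xs = "\<lambda>x a. Tup (map (x(j := a)) [0..<length fs])"
  define b where "b i = (SOME y. y \<in> gob (Bs ! i))" for i
  have b: "\<And>i. i < length fs \<Longrightarrow> i \<noteq> j \<Longrightarrow> b i \<in> gob (Bs ! i)"
    using reflexive_nonempty[OF base.prems(6)] by (simp add: b_def some_in_eq)
  \<comment> \<open>Lift the tuple with \<open>y\<close> in position \<open>j\<close> and
    \<open>b\<close> elsewhere. This also yields objects of the other \<open>As ! i\<close>, which
    are not assumed nonempty.\<close>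
  have lift: "\<exists>x. x j \<in> gob (As ! j) \<and> mob (fs ! j) (x j) = y \<and>
      (\<forall>i<length fs. i \<noteq> j \<longrightarrow> x i \<in> gob (As ! i))"
    if "y \<in> gob (Bs ! j)" for y
  proof -
    have "?xs b y \<in> gob (gprod 0 Bs)"
      using that b len by (auto simp: gob_gprod mem_tuples_iff simp del: gprod.simps)
    then have "?xs b y \<in> mob (gprod_map 0 fs) ` gob (gprod 0 As)"
      by (rule subsetD[OF trivial_fib_surj[OF base.prems(1)]])
    then obtain x where x: "?xs b y = mob (gprod_map 0 fs) x" "x \<in> gob (gprod 0 As)"
      by (rule imageE)
    from x(2) obtain xs where "x = Tup xs" "\<And>i. i < length fs \<Longrightarrow> xs ! i \<in> gob (As ! i)"
      using len by (auto simp: gob_gprod mem_tuples_iff simp del: gprod.simps)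
    with x(1)[symmetric] len show ?thesis
      by (intro exI[of _ "nth xs"]) (auto simp: mob_gprod_map)
  qed
  have "a = a'" if a: "a \<in> gob (As ! j)" "a' \<in> gob (As ! j)" "mob (fs ! j) a = mob (fs ! j) a'" for a a'
  proof -
    \<comment> \<open>Lifting the image of \<open>a\<close> produces the entries with which both
      \<open>a\<close> and \<open>a'\<close> are completed to tuples.\<close>
    obtain x where "\<forall>i<length fs. i \<noteq> j \<longrightarrow> x i \<in> gob (As ! i)"
      using lift[OF is_gmor_mob[OF base.prems(5) a(1)]] by blast
    then have "?xs x a \<in> gob (gprod 0 As)" "?xs x a' \<in> gob (gprod 0 As)"
      "mob (gprod_map 0 fs) (?xs x a) = mob (gprod_map 0 fs) (?xs x a')"
      using a len by (auto simp: gob_gprod mem_tuples_iff mob_gprod_map simp del: gprod.simps)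
    moreover have "inj_on (mob (gprod_map 0 fs)) (gob (gprod 0 As))"
      using base.prems(1) by (simp only: trivial_fib.simps)
    ultimately have "?xs x a = ?xs x a'"
      by (metis inj_onD)
    then show ?thesis using len by (auto dest: bspec[of _ _ j])
  qed
  moreover have "gob (Bs ! j) \<subseteq> mob (fs ! j) ` gob (As ! j)"
    using lift by blast
  ultimately show ?case by (simp add: inj_on_def)
next
  case (Suc n)
  note len = Suc.prems(2-4)
  let ?xs = "\<lambda>x a. Tup (map (x(j := a)) [0..<length fs])"
  define b where "b i = (SOME y. y \<in> gob (Bs ! i))" for i
  have b: "\<And>i. i < length fs \<Longrightarrow> i \<noteq> j \<Longrightarrow> b i \<in> gob (Bs ! i)"
    using reflexive_nonempty[OF Suc.prems(6)] by (simp add: b_def some_in_eq)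
  \<comment> \<open>The other entries are now also recorded to lie over \<open>b i\<close>, so that
    between completed tuples the other codomain factors contribute endo-homs of \<open>b i\<close>,
    where reflexivity applies.\<close>
  have lift: "\<exists>x. x j \<in> gob (As ! j) \<and> mob (fs ! j) (x j) = y \<and>
      (\<forall>i<length fs. i \<noteq> j \<longrightarrow> x i \<in> gob (As ! i) \<and> mob (fs ! i) (x i) = b i)"
    if "y \<in> gob (Bs ! j)" for y
  proof -
    have "?xs b y \<in> gob (gprod (Suc n) Bs)"
      using that b len by (auto simp: gob_gprod mem_tuples_iff simp del: gprod.simps)
    then have "?xs b y \<in> mob (gprod_map (Suc n) fs) ` gob (gprod (Suc n) As)"
      by (rule subsetD[OF trivial_fib_surj[OF Suc.prems(1)]])
    then obtain x where x: "?xs b y = mob (gprod_map (Suc n) fs) x" "x \<in> gob (gprod (Suc n) As)"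
      by (rule imageE)
    from x(2) obtain xs where "x = Tup xs" "\<And>i. i < length fs \<Longrightarrow> xs ! i \<in> gob (As ! i)"
      using len by (auto simp: gob_gprod mem_tuples_iff simp del: gprod.simps)
    with x(1)[symmetric] len show ?thesis
      by (intro exI[of _ "nth xs"]) (auto simp: mob_gprod_map)
  qed
  have "trivial_fib n (ghom (As ! j) a a') (ghom (Bs ! j) (mob (fs ! j) a) (mob (fs ! j) a'))
      (mhom (fs ! j) a a')" if a: "a \<in> gob (As ! j)" "a' \<in> gob (As ! j)" for a a'
  proof -
    obtain x where x: "\<forall>i<length fs. i \<noteq> j \<longrightarrow> x i \<in> gob (As ! i) \<and> mob (fs ! i) (x i) = b i"
      using lift[OF is_gmor_mob[OF Suc.prems(5) a(1)]] by blast
    have mem: "?xs x a \<in> gob (gprod (Suc n) As)" "?xs x a' \<in> gob (gprod (Suc n) As)"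
      using a x len by (auto simp: gob_gprod mem_tuples_iff simp del: gprod.simps)
    \<comment> \<open>The lists are spelled as in \<open>ghom_gprod\<close> and
      \<open>mhom_gprod_map\<close>, so that these equations can be folded in
      \<open>fib\<close>.\<close>
    let ?As = "map (\<lambda>i. ghom (As ! i) (entries (?xs x a) ! i) (entries (?xs x a') ! i)) [0..<length As]"
    let ?p = "mob (gprod_map (Suc n) fs)"
    let ?Bs = "map (\<lambda>i. ghom (Bs ! i) (entries (?p (?xs x a)) ! i)
      (entries (?p (?xs x a')) ! i)) [0..<length Bs]"
    let ?fs = "map (\<lambda>i. mhom (fs ! i) (entries (?xs x a) ! i) (entries (?xs x a') ! i)) [0..<length fs]"
    have fib: "trivial_fib n (gprod n ?As) (gprod n ?Bs) (gprod_map n ?fs)"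
      unfolding ghom_gprod[symmetric] mhom_gprod_map[symmetric]
      using Suc.prems(1) mem by (simp only: trivial_fib.simps)
    have "trivial_fib n (?As ! j) (?Bs ! j) (?fs ! j)"
    proof (rule Suc.IH[OF fib])
      show "is_gmor n (?As ! j) (?Bs ! j) (?fs ! j)"
        using Suc.prems(5) a len by (simp add: mob_gprod_map)
      fix i assume "i < length ?fs" "i \<noteq> j"
      then show "reflexive n (?Bs ! i)"
        using Suc.prems(6)[of i] x b len by (simp add: mob_gprod_map)
    qed (use len in auto)
    then show ?thesis using len by (simp add: mob_gprod_map)
  qed
  moreover have "gob (Bs ! j) \<subseteq> mob (fs ! j) ` gob (As ! j)"
    using lift by blast
  ultimately show ?case by simp
qed

text \<open>The hom from a tuple to itself is a product of endo-homs. The empty list is covered and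
  gives the terminal graph.\<close>

lemma reflexive_gprod: "(\<And>A. A \<in> set As \<Longrightarrow> reflexive n A) \<Longrightarrow> reflexive n (gprod n As)"
proof (induction n arbitrary: As)
  case 0
  then have "Tup (map (\<lambda>A. SOME a. a \<in> gob A) As) \<in> gob (gprod 0 As)"
    by (auto simp: gob_gprod mem_tuples_iff some_in_eq simp del: gprod.simps)
  then show ?case by auto
next
  case (Suc n)
  have "Tup (map (\<lambda>A. SOME a. a \<in> gob A) As) \<in> gob (gprod (Suc n) As)"
    using reflexive_nonempty[OF Suc.prems]
    by (auto simp: gob_gprod mem_tuples_iff some_in_eq simp del: gprod.simps)
  moreover have "reflexive n (ghom (gprod (Suc n) As) x x)" if "x \<in> gob (gprod (Suc n) As)" for x
    unfolding ghom_gprod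
    using that Suc.prems by (intro Suc.IH) (auto simp: mem_tuples_iff)
  ultimately show ?case by (auto simp del: gprod.simps)
qed


section \<open>Coproducts\<close>

lemma gcomp_gid_gtuple: "gcomp n (gid n) (gtuple n fs) = gtuple n fs"
  by (induction n arbitrary: fs) auto

lemma gcomp_gtuple_gid: "gcomp n (gtuple n fs) (gid n) = gtuple n fs"
  by (induction n arbitrary: fs) auto

text \<open>The coproduct of the maps \<open>g t\<close> over a fixed index set. The homs of
  \<open>fc_map\<close> take this shape when the map on objects is the identity.\<close>

definition gcoprod_map :: "nat \<Rightarrow> ('a cell list \<Rightarrow> 'a gmor) \<Rightarrow> 'a gmor" where
  "gcoprod_map n g = gcase n (\<lambda>z. gcomp n (ginj n (tag z)) (gcomp n (g (tag z)) (guntag n)))"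

lemma gob_gcoprod: "gob (gcoprod n I A) = {Tag t x | t x. t \<in> I \<and> x \<in> gob (A t)}"
  by (cases n) (auto simp: gcoprod_def)

lemma ghom_gcoprod: "ghom (gcoprod (Suc n) I A) z w =
    (if tag z = tag w then ghom (A (tag z)) (untag z) (untag w) else gempty n)"
  by (simp add: gcoprod_def)

lemma mob_gcoprod_map: "mob (gcoprod_map n g) z = Tag (tag z) (mob (g (tag z)) (untag z))"
  by (cases n) (auto simp: gcoprod_map_def gcase_def ginj_def guntag_def)

text \<open>
  The summands are required to be of the form \<open>gprod_map n fs\<close> because \<open>gcomp n (gid n) f = f\<close>
  fails for terms \<open>f\<close> of the wrong depth.
\<close>

lemma mhom_gcoprod_map: "mhom (gcoprod_map (Suc n) (\<lambda>t. gprod_map (Suc n) (fs t))) z w =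
    mhom (gprod_map (Suc n) (fs (tag z))) (untag z) (untag w)"
  by (simp add: gcoprod_map_def gcase_def ginj_def guntag_def gprod_map_def
      gcomp_gid_gtuple gcomp_gtuple_gid)

lemma is_gmor_gempty: "is_gmor n (gempty n) B p"
  by (cases n) auto

text \<open>Meant for homs between different summands: there \<open>p\<close> is a meaningless value
  of \<open>gcase\<close>, but domain and codomain are both empty.\<close>

lemma trivial_fib_gempty: "trivial_fib n (gempty n) (gempty n) p"
  by (cases n) auto

lemma is_gmor_gcoprod_map:
  assumes "\<And>t. t \<in> I \<Longrightarrow> is_gmor n (A t) (B t) (gprod_map n (fs t))"
  shows "is_gmor n (gcoprod n I A) (gcoprod n I B) (gcoprod_map n (\<lambda>t. gprod_map n (fs t)))"
proof -
  have "mob (gcoprod_map n (\<lambda>t. gprod_map n (fs t))) ` gob (gcoprod n I A) \<subseteq> gob (gcoprod n I B)"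
    using is_gmor_mob[OF assms] by (auto simp: gob_gcoprod mob_gcoprod_map)
  with assms show ?thesis
    by (cases n)
      (auto simp: gob_gcoprod mob_gcoprod_map mhom_gcoprod_map ghom_gcoprod is_gmor_gempty)
qed

text \<open>Tags are preserved, so surjectivity and injectivity are checked one summand at a time,
  and homs across summands impose no condition.\<close>

lemma trivial_fib_gcoprod_map_iff:
  "trivial_fib n (gcoprod n I A) (gcoprod n I B) (gcoprod_map n (\<lambda>t. gprod_map n (fs t))) \<longleftrightarrow>
    (\<forall>t\<in>I. trivial_fib n (A t) (B t) (gprod_map n (fs t)))"
proof -
  let ?q = "gcoprod_map n (\<lambda>t. gprod_map n (fs t))"
  have surj: "gob (gcoprod n I B) \<subseteq> mob ?q ` gob (gcoprod n I A) \<longleftrightarrow>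
    (\<forall>t\<in>I. gob (B t) \<subseteq> mob (gprod_map n (fs t)) ` gob (A t))" (is "?L \<longleftrightarrow> ?R")
  proof
    assume L: ?L
    show ?R
    proof (intro ballI subsetI)
      fix t y assume "t \<in> I" "y \<in> gob (B t)"
      then have "Tag t y \<in> mob ?q ` gob (gcoprod n I A)"
        by (intro subsetD[OF L]) (simp add: gob_gcoprod)
      then show "y \<in> mob (gprod_map n (fs t)) ` gob (A t)"
        by (auto simp: gob_gcoprod mob_gcoprod_map)
    qed
  next
    assume R: ?R
    show ?L
    proof
      fix z assume "z \<in> gob (gcoprod n I B)"
      then obtain t y where z: "z = Tag t y" "t \<in> I" "y \<in> gob (B t)"
        by (auto simp: gob_gcoprod)
      with R obtain x where x: "y = mob (gprod_map n (fs t)) x" "x \<in> gob (A t)"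
        by blast
      show "z \<in> mob ?q ` gob (gcoprod n I A)"
        using z x by (intro image_eqI[of _ _ "Tag t x"]) (simp_all add: gob_gcoprod mob_gcoprod_map)
    qed
  qed
  show ?thesis
  proof (cases n)
    case 0
    let ?p = "gcoprod_map 0 (\<lambda>t. gprod_map 0 (fs t))"
    have "inj_on (mob ?p) (gob (gcoprod 0 I A)) \<longleftrightarrow>
      (\<forall>t\<in>I. inj_on (mob (gprod_map 0 (fs t))) (gob (A t)))" (is "?L \<longleftrightarrow> ?R")
    proof
      assume L: ?L
      show ?R
      proof (intro ballI inj_onI)
        fix t x y
        assume "t \<in> I" "x \<in> gob (A t)" "y \<in> gob (A t)"
          "mob (gprod_map 0 (fs t)) x = mob (gprod_map 0 (fs t)) y"
        then have "Tag t x = Tag t y"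
          by - (rule inj_onD[OF L], simp_all add: gob_gcoprod mob_gcoprod_map)
        then show "x = y" by simp
      qed
    next
      assume ?R
      then show ?L
        by (auto simp: gob_gcoprod mob_gcoprod_map inj_on_def)
    qed
    with surj show ?thesis unfolding 0 trivial_fib.simps by blast
  next
    case (Suc m)
    let ?p = "gcoprod_map (Suc m) (\<lambda>t. gprod_map (Suc m) (fs t))"
    let ?fib_p = "\<lambda>z w. trivial_fib m (ghom (gcoprod (Suc m) I A) z w)
          (ghom (gcoprod (Suc m) I B) (mob ?p z) (mob ?p w)) (mhom ?p z w)"
    let ?fib = "\<lambda>t a b. trivial_fib m (ghom (A t) a b)
        (ghom (B t) (mob (gprod_map (Suc m) (fs t)) a) (mob (gprod_map (Suc m) (fs t)) b))
        (mhom (gprod_map (Suc m) (fs t)) a b)"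
    have same: "?fib_p (Tag t a) (Tag t b) \<longleftrightarrow> ?fib t a b" for t a b
      by (simp add: mob_gcoprod_map mhom_gcoprod_map ghom_gcoprod)
    have different: "?fib_p (Tag t a) (Tag u b)" if "t \<noteq> u" for t u a b
      using that by (simp add: mob_gcoprod_map ghom_gcoprod trivial_fib_gempty)
    have "(\<forall>z\<in>gob (gcoprod (Suc m) I A). \<forall>w\<in>gob (gcoprod (Suc m) I A). ?fib_p z w) \<longleftrightarrow>
      (\<forall>t\<in>I. \<forall>a\<in>gob (A t). \<forall>b\<in>gob (A t). ?fib t a b)" (is "?L \<longleftrightarrow> ?R")
    proof
      assume L: ?L
      show ?R
      proof (intro ballI)
        fix t a b assume "t \<in> I" "a \<in> gob (A t)" "b \<in> gob (A t)"
        then have "?fib_p (Tag t a) (Tag t b)"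
          by (intro L[rule_format]) (simp_all add: gob_gcoprod)
        then show "?fib t a b" by (simp only: same)
      qed
    next
      assume R: ?R
      show ?L
      proof (intro ballI)
        fix z w assume "z \<in> gob (gcoprod (Suc m) I A)" "w \<in> gob (gcoprod (Suc m) I A)"
        then obtain t a u b where z: "z = Tag t a" "t \<in> I" "a \<in> gob (A t)"
          and w: "w = Tag u b" "b \<in> gob (A u)"
          by (auto simp: gob_gcoprod)
        show "?fib_p z w"
        proof (cases "t = u")
          case True
          with R z w have "?fib t a b" by blast
          with True show ?thesis unfolding z w by (simp only: same)
        next
          case False
          then show ?thesis unfolding z w by (rule different)
        qed
      qed
    qed
    with surj show ?thesis unfolding Suc trivial_fib.simps by blast
  qed
qed

lemma reflexive_gcoprod:
  assumes "I \<noteq> {}" "\<And>t. t \<in> I \<Longrightarrow> reflexive n (A t)"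
  shows "reflexive n (gcoprod n I A)"
proof -
  have "gob (gcoprod n I A) \<noteq> {}"
    using assms reflexive_nonempty[OF assms(2)] by (fastforce simp: gob_gcoprod)
  with assms(2) show ?thesis
    by (cases n) (auto simp: gob_gcoprod ghom_gcoprod)
qed


section \<open>Contractible objects\<close>

lemma is_gmor_terminal: "is_gmor n A (gprod n []) (gtuple n [])"
  by (induction n arbitrary: A) (auto simp: tuples_Nil)

text \<open>Over the single object of the terminal graph, surjectivity means having an object, and
  in depth 0 injectivity adds uniqueness; the homs of the terminal graph are terminal again.\<close>

lemma contr_iff_trivial_fib:
  "A \<in> obj (V_cat P n) \<Longrightarrow>
    A \<in> contr (V_cat P n) \<longleftrightarrow> trivial_fib n (U_gph n A) (gprod n []) (gtuple n [])"
proof (induction n arbitrary: A)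
  case 0
  then obtain X where "A = VSet X" by (auto simp: Set_cat_def)
  then show ?case by (auto simp: Set_cat_def tuples_Nil inj_on_def)
next
  case (Suc n)
  then have "is_PCat (V_cat P n) (P n) A" by (simp add: PCat_def)
  moreover from this have "vhom A a b \<in> obj (V_cat P n)" if "a \<in> vob A" "b \<in> vob A" for a b
    using that by (simp add: is_PCat_def)
  ultimately show ?case
    using Suc.IH by (auto simp: PCat_def tuples_Nil)
qed

text \<open>Identifies the operations of the terminal operad, so that the first factor in the homs
  of \<open>T_obj\<close> becomes \<open>gprod n []\<close>.\<close>

lemma U_gph_terminal: "U_gph n (prd (strict_cat n) []) = gprod n []"
  by (induction n) (auto simp: Set_cat_def PCat_def PCat_prd_def hom_tuple_def)


section \<open>The collection \<open>Q\<^sup>(\<^sup>n\<^sup>)1 \<rightarrow> T\<^sup>(\<^sup>n\<^sup>)1\<close>\<close>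

abbreviation Q_one :: "(nat \<Rightarrow> 'a voperad) \<Rightarrow> nat \<Rightarrow> 'a gph" where
  "Q_one P n \<equiv> Q_obj P n (gprod n [])"

lemma path_homs_const: "path_homs (\<lambda>a b. c) as = replicate (length as - 1) c"
  by (simp add: path_homs_def map_replicate_const)

lemma gob_Q_one: "gob (Q_one P n) = {Tup []}"
  by (cases n) (auto simp: fc_def gstar_def tuples_Nil)

text \<open>All objects in a string coincide, so the summand at a string of \<open>k + 1\<close>
  objects has \<open>k\<close> equal factors besides the operations.\<close>

lemma ghom_Q_one: "ghom (Q_one P (Suc n)) a b =
    gcoprod n (paths {Tup []} a b) (\<lambda>as.
      gprod n (U_gph n (op_obj (P n) (length as - 1)) # replicate (length as - 1) (Q_one P n)))"
  by (simp add: fc_def gstar_def tuples_Nil path_homs_const)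

lemma ghom_T_one: "ghom (Q_one one_operads (Suc n)) a b =
    gcoprod n (paths {Tup []} a b) (\<lambda>as.
      gprod n (gprod n [] # replicate (length as - 1) (Q_one one_operads n)))"
  unfolding ghom_Q_one by (simp add: one_operads_def terminal_operad_def U_gph_terminal)

lemma mob_Q_to_T: "mob (Q_to_T n) a = a"
  by (cases n) (auto simp: fc_map_def)

lemma mhom_Q_to_T: "mhom (Q_to_T (Suc n)) a b =
    gcoprod_map n (\<lambda>as. gprod_map n (gtuple n [] # replicate (length as - 1) (Q_to_T n)))"
  by (simp add: fc_map_def gcoprod_map_def path_homs_const Let_def)

lemma nth_Cons_replicate: "i < Suc k \<Longrightarrow> (x # replicate k y) ! i = (if i = 0 then x else y)"
  by (cases i) auto

lemma is_gmor_Q_to_T: "is_gmor n (Q_one P n) (Q_one one_operads n) (Q_to_T n)"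
proof (induction n)
  case 0
  show ?case by auto
next
  case (Suc n)
  have "is_gmor n (ghom (Q_one P (Suc n)) a b) (ghom (Q_one one_operads (Suc n)) a b)
      (mhom (Q_to_T (Suc n)) a b)" for a b
    unfolding ghom_Q_one[of P] ghom_T_one mhom_Q_to_T
    by (intro is_gmor_gcoprod_map is_gmor_gprod_map)
      (auto simp: nth_Cons_replicate is_gmor_terminal Suc)
  then show ?case
    by (simp only: is_gmor.simps gob_Q_one mob_Q_to_T image_insert image_empty) blast
qed

lemma reflexive_gprod_Nil: "reflexive n (gprod n [])"
  by (rule reflexive_gprod) simp

text \<open>\<open>Suc k\<close> objects form a string with \<open>k\<close> steps, so every arity
  occurs, \<open>k = 0\<close> included.\<close>

lemma replicate_mem_paths: "replicate (Suc k) a \<in> paths {a} a a"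
  unfolding paths_def by (auto simp: last_replicate simp del: replicate.simps)

text \<open>Supplies the cells needed to cancel factors: on the strict side the operations are
  terminal, and products and nonempty coproducts preserve reflexivity.\<close>

lemma reflexive_T_one: "reflexive n (Q_one (one_operads :: nat \<Rightarrow> 'a voperad) n)"
proof (induction n)
  case 0
  show ?case by (simp add: tuples_Nil)
next
  case (Suc n)
  have "paths {Tup [] :: 'a cell} (Tup []) (Tup []) \<noteq> {}"
    by (metis replicate_mem_paths empty_iff)
  then have "reflexive n (ghom (Q_one one_operads (Suc n)) (Tup [] :: 'a cell) (Tup []))"
    unfolding ghom_T_one
    using Suc reflexive_gprod_Nil
    by (intro reflexive_gcoprod reflexive_gprod) (auto split: if_splits)
  then show ?case by (simp only: reflexive.simps gob_Q_one) blast
qed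

text \<open>Both graphs have the one object \<open>Tup []\<close>, which \<open>Q_to_T\<close>
  fixes, so surjectivity on 0-cells is automatic.\<close>

lemma trivial_fib_Q_to_T_iff:
  "trivial_fib n (Q_one P n) (Q_one one_operads n) (Q_to_T n) \<longleftrightarrow>
    contractible_globular_operad n (Q_operad P n)"
  by (simp add: trivial_fib_iff_contractible_collection is_gmor_Q_to_T gob_Q_one mob_Q_to_T
      contractible_globular_operad_def Q_operad_def)

lemma trivial_fib_Q_to_T_Suc:
  fixes P :: "nat \<Rightarrow> 'a voperad"
  shows "trivial_fib (Suc n) (Q_one P (Suc n)) (Q_one one_operads (Suc n)) (Q_to_T (Suc n)) \<longleftrightarrow>
    trivial_fib n (Q_one P n) (Q_one one_operads n) (Q_to_T n) \<and>
    (\<forall>k. trivial_fib n (U_gph n (op_obj (P n) k)) (gprod n []) (gtuple n []))"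
    (is "?L \<longleftrightarrow> ?Q \<and> ?P")
proof -
  let ?As = "\<lambda>k. U_gph n (op_obj (P n) k) # replicate k (Q_one P n)"
  let ?Bs = "\<lambda>k. gprod n [] # replicate k (Q_one one_operads n)"
  let ?fs = "\<lambda>k. gtuple n [] # replicate k (Q_to_T n)"
  have "?L \<longleftrightarrow> trivial_fib n (ghom (Q_one P (Suc n)) (Tup []) (Tup []))
      (ghom (Q_one one_operads (Suc n)) (Tup []) (Tup [])) (mhom (Q_to_T (Suc n)) (Tup []) (Tup []))"
    by (simp only: trivial_fib.simps gob_Q_one mob_Q_to_T image_insert image_empty) blast
  also have "\<dots> \<longleftrightarrow> (\<forall>as\<in>paths {Tup [] :: 'a cell} (Tup []) (Tup []).
      trivial_fib n (gprod n (?As (length as - 1))) (gprod n (?Bs (length as - 1)))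
        (gprod_map n (?fs (length as - 1))))"
    unfolding ghom_Q_one[of P] ghom_T_one mhom_Q_to_T trivial_fib_gcoprod_map_iff ..
  \<comment> \<open>Only the length of a string matters, and every arity is realised.\<close>
  also have "\<dots> \<longleftrightarrow> (\<forall>k. trivial_fib n (gprod n (?As k)) (gprod n (?Bs k)) (gprod_map n (?fs k)))"
    using replicate_mem_paths by (metis diff_Suc_1 length_replicate)
  also have "\<dots> \<longleftrightarrow> ?Q \<and> ?P"
  proof
    assume fib: "\<forall>k. trivial_fib n (gprod n (?As k)) (gprod n (?Bs k)) (gprod_map n (?fs k))"
    have factor: "trivial_fib n (?As k ! j) (?Bs k ! j) (?fs k ! j)" if "j < Suc k" for j k
      using that
      by (intro trivial_fib_gprod_mapD[OF fib[rule_format]])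
        (auto simp: nth_Cons_replicate is_gmor_terminal is_gmor_Q_to_T
          reflexive_gprod_Nil reflexive_T_one)
    \<comment> \<open>In arity 1, position 1 holds \<open>Q_to_T n\<close>; in each arity
      \<open>k\<close>, position 0 holds the map from the \<open>k\<close>-ary operations of
      \<open>P n\<close> to the terminal graph.\<close>
    from factor[of 1 1] have ?Q by simp
    moreover have ?P using factor[of 0] by simp
    ultimately show "?Q \<and> ?P" ..
  next
    assume "?Q \<and> ?P"
    then show "\<forall>k. trivial_fib n (gprod n (?As k)) (gprod n (?Bs k)) (gprod_map n (?fs k))"
      by (intro allI trivial_fib_gprod_map) (auto simp: nth_Cons_replicate)
  qed
  finally show ?thesis .
qed

theorem proposition4p7:
  fixes P :: "nat \<Rightarrow> 'a voperad" and n :: nat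
  assumes "\<And>i. is_operad (V_cat P i) (P i)"
  shows "contractible_globular_operad n (Q_operad P n) \<longleftrightarrow>
    (\<forall>i<n. contractible_operad (V_cat P i) (P i))"
proof -
  \<comment> \<open>The induction runs on trivial fibrations, the form in which the recursion is
    available; it starts from the identity of a one-point set.\<close>
  have "trivial_fib n (Q_one P n) (Q_one one_operads n) (Q_to_T n) \<longleftrightarrow>
    (\<forall>i<n. contractible_operad (V_cat P i) (P i))"
  proof (induction n)
    case 0
    show ?case by auto
  next
    case (Suc n)
    \<comment> \<open>Membership in \<open>obj\<close> is what allows contractibility of
      \<open>P n\<close> to be read as a trivial fibration.\<close>
    have "op_obj (P n) k \<in> obj (V_cat P n)" for k
      using assms by (simp add: is_operad_def)
    then show ?case
      unfolding trivial_fib_Q_to_T_Suc Suc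
      by (auto simp: contractible_operad_def contr_iff_trivial_fib less_Suc_eq)
  qed
  then show ?thesis by (simp only: trivial_fib_Q_to_T_iff)
qed

end
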